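(* Let $A$ be an algebra and $I$ a subsemigroup of $\mathrm{End}(A)$ such that $A$ is both $I$-representable and $I$-separable. Let $S=S(A,I)$ be the idealiser of $I$ in $\mathrm{End}(A)$. Then $$\widetilde{\mathrm{P}}(I)=\{\rho_f: f\in S\},\quad \widetilde{\Lambda}(I)=\{\lambda_f: f\in S\}\quad\text{and}\quad \Omega(I)=\{(\lambda_f,\rho_f): f\in S\}.$$ In particular, $$\widetilde{\mathrm{P}}(I)\cong\Omega(I)\cong\widetilde{\Lambda}(I)\quad\text{and}\quad \widetilde{\mathrm{P}}(I)\cong S\cong\widetilde{\Lambda}(I)$$ via natural isomorphisms.
   Context: An algebra is a set $A$ with a collection of finitary operations; $\mathrm{End}(A)$ is its endomorphism monoid. Maps of $A$ are written on the right and composed left to right. Subsemigroups are non-empty. Translations. A right translation of a semigroup $I$ is a map $\rho:I\to I$ (written on the right) with $(\alpha\beta)\rho=\alpha(\beta\rho)$ for all $\alpha,\beta\in I$; a left translation is a map $\lambda:I\to I$ (written on the left) with $\lambda(\alpha\beta)=\lambda(\alpha)\beta$. A pair $(\lambda,\rho)$ of a left and a right translation is a bi-translation (is linked) if $\alpha\lambda(\beta)=(\alpha\rho)\beta$ for all $\alpha,\beta\in I$. $\Omega(I)$ (the translational hull) is the set of all bi-translations, a semigroup under $(\lambda,\rho)(\lambda',\rho')=(\lambda\lambda',\rho\rho')$, where $(\lambda\lambda')(\alpha)=\lambda(\lambda'(\alpha))$ and $\alpha(\rho\rho')=(\alpha\rho)\rho'$. $\widetilde{\Lambda}(I)$ and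 $\widetilde{\mathrm{P}}(I)$ are the images of $\Omega(I)$ under projection to the first and second coordinates, respectively (semigroups under the compositions $(\lambda\lambda')(\alpha)=\lambda(\lambda'(\alpha))$ and $\alpha(\rho\rho')=(\alpha\rho)\rho'$, respectively). $S(A,I)=\{f\in\mathrm{End}(A): f\alpha\in I\text{ and }\alpha f\in I\text{ for all }\alpha\in I\}$. For such $f$, $\lambda_f(\alpha)=f\alpha$ and $\alpha\rho_f=\alpha f$ for $\alpha\in I$. $\mathrm{Im}\,I=\bigcup_{\alpha\in I}\mathrm{Im}\,\alpha$ and $\ker I=\bigcap_{\alpha\in I}\ker\alpha$, where $\ker\alpha=\{(a,b)\in A\times A: a\alpha=b\alpha\}$. $A$ is $I$-representable if $\mathrm{Im}\,I$ generates $A$ as an algebra; $A$ is $I$-separable if $\ker I$ is the equality relation on $A$. The natural morphisms are the coordinate projections $\Omega(I)\to\widetilde{\mathrm{P}}(I)$ and $\Omega(I)\to\widetilde{\Lambda}(I)$, and the maps $f\mapsto\rho_f$, $f\mapsto\lambda_f$ and $f\mapsto(\lambda_f,\rho_f)$ on $S$. A natural isomorphism is one of these morphisms (or an inverse or composite of such) that is an isomorphism. *)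

theory Defs
  imports "HOL-Algebra.Group" "HOL-Library.FuncSet" "HOL.Hull"
begin

section \<open>Algebras and their endomorphism monoids\<close>

text \<open>
  An algebra is a carrier \<open>A\<close> together with a set \<open>F\<close> of finitary operations. An operation is a
  pair \<open>(n, f)\<close> of an arity and a function on lists, of which only the values on lists of length
  \<open>n\<close> over \<open>A\<close> matter; \<open>n = 0\<close> gives constants.
\<close>

type_synonym 'a operation = "nat \<times> ('a list \<Rightarrow> 'a)"

definition subuniverse :: "'a operation set \<Rightarrow> 'a set \<Rightarrow> bool" where
  "subuniverse F B \<longleftrightarrow>
     (\<forall>(n, f) \<in> F. \<forall>xs. length xs = n \<longrightarrow> set xs \<subseteq> B \<longrightarrow> f xs \<in> B)"

definition alg :: "'a set \<Rightarrow> 'a operation set \<Rightarrow> bool" where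
  "alg A F \<longleftrightarrow> subuniverse F A"

text \<open>
  Maps of \<open>A\<close> are extensional functions, so that equality of maps is equality in HOL. Since maps
  act on the right, the product \<open>\<alpha> \<beta>\<close> in the endomorphism monoid is first \<open>\<alpha>\<close>, then \<open>\<beta>\<close>.
\<close>

definition endomorphisms :: "'a set \<Rightarrow> 'a operation set \<Rightarrow> ('a \<Rightarrow> 'a) set" where
  "endomorphisms A F = {h \<in> A \<rightarrow>\<^sub>E A.
     \<forall>(n, f) \<in> F. \<forall>xs. length xs = n \<longrightarrow> set xs \<subseteq> A \<longrightarrow> h (f xs) = f (map h xs)}"

definition End :: "'a set \<Rightarrow> 'a operation set \<Rightarrow> ('a \<Rightarrow> 'a) monoid" where
  "End A F = \<lparr>carrier = endomorphisms A F,
              monoid.mult = (\<lambda>\<alpha> \<beta>. compose A \<beta> \<alpha>),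
              one = (\<lambda>x\<in>A. x)\<rparr>"

definition Im_of :: "'a set \<Rightarrow> ('a \<Rightarrow> 'a) set \<Rightarrow> 'a set" where
  "Im_of A I = (\<Union>\<alpha>\<in>I. \<alpha> ` A)"

definition ker_map :: "'a set \<Rightarrow> ('a \<Rightarrow> 'a) \<Rightarrow> ('a \<times> 'a) set" where
  "ker_map A \<alpha> = {(a, b) \<in> A \<times> A. \<alpha> a = \<alpha> b}"

definition ker_of :: "'a set \<Rightarrow> ('a \<Rightarrow> 'a) set \<Rightarrow> ('a \<times> 'a) set" where
  "ker_of A I = (\<Inter>\<alpha>\<in>I. ker_map A \<alpha>)"

definition representable :: "'a set \<Rightarrow> 'a operation set \<Rightarrow> ('a \<Rightarrow> 'a) set \<Rightarrow> bool" where
  "representable A F I \<longleftrightarrow> subuniverse F hull (Im_of A I) = A"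

definition separable :: "'a set \<Rightarrow> ('a \<Rightarrow> 'a) set \<Rightarrow> bool" where
  "separable A I \<longleftrightarrow> ker_of A I = Id_on A"


section \<open>Subsemigroups and translations\<close>

text \<open>
  Semigroups are given as monoid records of which only the carrier and the multiplication are used.
  In particular a subsemigroup \<open>I\<close> of \<open>G\<close> is the structure \<open>G\<lparr>carrier := I\<rparr>\<close>, whose \<open>one\<close> field
  need not lie in \<open>I\<close> and plays no role; likewise \<open>hom\<close> and \<open>iso\<close> refer to multiplication only.
\<close>

definition subsemigroup :: "'b set \<Rightarrow> ('b, 'c) monoid_scheme \<Rightarrow> bool" where
  "subsemigroup I G \<longleftrightarrow>
     I \<noteq> {} \<and> I \<subseteq> carrier G \<and> (\<forall>\<alpha>\<in>I. \<forall>\<beta>\<in>I. \<alpha> \<otimes>\<^bsub>G\<^esub> \<beta> \<in> I)"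

definition idealiser :: "('b, 'c) monoid_scheme \<Rightarrow> 'b set \<Rightarrow> 'b set" where
  "idealiser G I = {f \<in> carrier G. \<forall>\<alpha>\<in>I. f \<otimes>\<^bsub>G\<^esub> \<alpha> \<in> I \<and> \<alpha> \<otimes>\<^bsub>G\<^esub> f \<in> I}"

definition left_translation :: "('b, 'c) monoid_scheme \<Rightarrow> ('b \<Rightarrow> 'b) \<Rightarrow> bool" where
  "left_translation G l \<longleftrightarrow> l \<in> carrier G \<rightarrow>\<^sub>E carrier G \<and>
     (\<forall>\<alpha>\<in>carrier G. \<forall>\<beta>\<in>carrier G. l (\<alpha> \<otimes>\<^bsub>G\<^esub> \<beta>) = l \<alpha> \<otimes>\<^bsub>G\<^esub> \<beta>)"

definition right_translation :: "('b, 'c) monoid_scheme \<Rightarrow> ('b \<Rightarrow> 'b) \<Rightarrow> bool" where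
  "right_translation G r \<longleftrightarrow> r \<in> carrier G \<rightarrow>\<^sub>E carrier G \<and>
     (\<forall>\<alpha>\<in>carrier G. \<forall>\<beta>\<in>carrier G. r (\<alpha> \<otimes>\<^bsub>G\<^esub> \<beta>) = \<alpha> \<otimes>\<^bsub>G\<^esub> r \<beta>)"

definition bi_translation :: "('b, 'c) monoid_scheme \<Rightarrow> ('b \<Rightarrow> 'b) \<times> ('b \<Rightarrow> 'b) \<Rightarrow> bool" where
  "bi_translation G = (\<lambda>(l, r). left_translation G l \<and> right_translation G r \<and>
     (\<forall>\<alpha>\<in>carrier G. \<forall>\<beta>\<in>carrier G. \<alpha> \<otimes>\<^bsub>G\<^esub> l \<beta> = r \<alpha> \<otimes>\<^bsub>G\<^esub> \<beta>))"

text \<open>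
  Left translations are written on the left and right translations on the right, so the product of
  \<open>l\<close> and \<open>l'\<close> applies \<open>l'\<close> first, whereas the product of \<open>r\<close> and \<open>r'\<close> applies \<open>r\<close> first.
\<close>

definition Omega :: "('b, 'c) monoid_scheme \<Rightarrow> (('b \<Rightarrow> 'b) \<times> ('b \<Rightarrow> 'b)) monoid" where
  "Omega G = \<lparr>carrier = {p. bi_translation G p},
              monoid.mult = (\<lambda>(l, r) (l', r'). (compose (carrier G) l l', compose (carrier G) r' r)),
              one = (\<lambda>x\<in>carrier G. x, \<lambda>x\<in>carrier G. x)\<rparr>"

definition Lambda_tilde :: "('b, 'c) monoid_scheme \<Rightarrow> ('b \<Rightarrow> 'b) monoid" where
  "Lambda_tilde G = \<lparr>carrier = fst ` carrier (Omega G),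
                     monoid.mult = (\<lambda>l l'. compose (carrier G) l l'),
                     one = (\<lambda>x\<in>carrier G. x)\<rparr>"

definition Rho_tilde :: "('b, 'c) monoid_scheme \<Rightarrow> ('b \<Rightarrow> 'b) monoid" where
  "Rho_tilde G = \<lparr>carrier = snd ` carrier (Omega G),
                  monoid.mult = (\<lambda>r r'. compose (carrier G) r' r),
                  one = (\<lambda>x\<in>carrier G. x)\<rparr>"

definition lambda_of :: "('b, 'c) monoid_scheme \<Rightarrow> 'b set \<Rightarrow> 'b \<Rightarrow> 'b \<Rightarrow> 'b" where
  "lambda_of G I f = (\<lambda>\<alpha>\<in>I. f \<otimes>\<^bsub>G\<^esub> \<alpha>)"

definition rho_of :: "('b, 'c) monoid_scheme \<Rightarrow> 'b set \<Rightarrow> 'b \<Rightarrow> 'b \<Rightarrow> 'b" where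
  "rho_of G I f = (\<lambda>\<alpha>\<in>I. \<alpha> \<otimes>\<^bsub>G\<^esub> f)"

end

theory Submission
  imports Defs
begin

text \<open>
  Let \<open>(\<lambda>, \<rho>)\<close> be a bi-translation of \<open>I\<close>. The elements \<open>a\<close> of \<open>A\<close> for which some \<open>b\<close> satisfies
  \<open>b\<beta> = a(\<lambda>\<beta>)\<close> for all \<open>\<beta> \<in> I\<close> form a subuniverse, and linkedness puts \<open>Im I\<close> into it (for
  \<open>a = x\<alpha>\<close> take \<open>b = x(\<alpha>\<rho>)\<close>). Representability then provides such a \<open>b\<close> for every \<open>a\<close>, and
  separability makes it unique, so that \<open>a \<mapsto> b\<close> is an endomorphism \<open>f\<close> with \<open>f\<beta> = \<lambda>\<beta>\<close>.
  Separability applied to \<open>x\<alpha>f\<beta> = x\<alpha>(\<lambda>\<beta>) = x(\<alpha>\<rho>)\<beta>\<close> gives \<open>\<alpha>f = \<alpha>\<rho>\<close>. Conversely \<open>\<lambda>\<^sub>f\<close> determines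
  \<open>f\<close> by separability, and \<open>\<rho>\<^sub>f\<close> does by representability.
\<close>

section \<open>Translations induced by the idealiser\<close>

text \<open>All three identities are associativity in \<open>G\<close>. Closure of \<open>I\<close>
  is what lets the restricted maps be evaluated at products.\<close>

lemma bi_translation_idealiser:
  assumes "monoid G" and "I \<subseteq> carrier G" and "f \<in> idealiser G I"
    and "\<And>\<alpha> \<beta>. \<alpha> \<in> I \<Longrightarrow> \<beta> \<in> I \<Longrightarrow> \<alpha> \<otimes>\<^bsub>G\<^esub> \<beta> \<in> I"
  shows "bi_translation (G\<lparr>carrier := I\<rparr>) (lambda_of G I f, rho_of G I f)"
proof -
  interpret monoid G by fact
  show ?thesis
    using assms(2-)
    by (auto simp: bi_translation_def left_translation_def right_translation_def
        lambda_of_def rho_of_def idealiser_def m_assoc subset_eq)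
qed

text \<open>The factor acting first is taken from the idealiser, so its values stay in
  \<open>I\<close>, where the restricted outer map is given by multiplication; then associativity
  applies. The same holds for \<open>rho_of_mult\<close>.\<close>

lemma lambda_of_mult:
  assumes "monoid G" and "I \<subseteq> carrier G" and "f \<in> carrier G" and "g \<in> idealiser G I"
  shows "lambda_of G I (f \<otimes>\<^bsub>G\<^esub> g) = compose I (lambda_of G I f) (lambda_of G I g)"
proof -
  interpret monoid G by fact
  show ?thesis
    using assms(2-)
    by (auto simp: fun_eq_iff lambda_of_def compose_def idealiser_def m_assoc subset_eq)
qed

lemma rho_of_mult:
  assumes "monoid G" and "I \<subseteq> carrier G" and "f \<in> idealiser G I" and "g \<in> carrier G"
  shows "rho_of G I (f \<otimes>\<^bsub>G\<^esub> g) = compose I (rho_of G I g) (rho_of G I f)"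
proof -
  interpret monoid G by fact
  show ?thesis
    using assms(2-)
    by (auto simp: fun_eq_iff rho_of_def compose_def idealiser_def m_assoc subset_eq)
qed

section \<open>Endomorphisms of representable and separable algebras\<close>

lemma carrier_End [simp]: "carrier (End A F) = endomorphisms A F"
  and mult_End [simp]: "\<alpha> \<otimes>\<^bsub>End A F\<^esub> \<beta> = compose A \<beta> \<alpha>"
  by (simp_all add: End_def)

lemma endomorphisms_PiE: "h \<in> endomorphisms A F \<Longrightarrow> h \<in> A \<rightarrow>\<^sub>E A"
  by (simp add: endomorphisms_def)

lemma endomorphisms_mem: "h \<in> endomorphisms A F \<Longrightarrow> a \<in> A \<Longrightarrow> h a \<in> A"
  by (auto simp: endomorphisms_def)

lemma endomorphisms_op:
  "h \<in> endomorphisms A F \<Longrightarrow> (length xs, \<omega>) \<in> F \<Longrightarrow> set xs \<subseteq> A \<Longrightarrow> h (\<omega> xs) = \<omega> (map h xs)"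
  by (auto simp: endomorphisms_def)

lemma endomorphismsI:
  assumes "h \<in> A \<rightarrow>\<^sub>E A"
    and "\<And>\<omega> xs. (length xs, \<omega>) \<in> F \<Longrightarrow> set xs \<subseteq> A \<Longrightarrow> h (\<omega> xs) = \<omega> (map h xs)"
  shows "h \<in> endomorphisms A F"
  using assms by (auto simp: endomorphisms_def)

lemma endomorphisms_ext:
  assumes "f \<in> endomorphisms A F" and "g \<in> endomorphisms A F" and "\<And>a. a \<in> A \<Longrightarrow> f a = g a"
  shows "f = g"
  using endomorphisms_PiE[OF assms(1)] endomorphisms_PiE[OF assms(2)] assms(3) by (rule PiE_ext)

lemma subuniverse_op:
  "subuniverse F B \<Longrightarrow> (length xs, \<omega>) \<in> F \<Longrightarrow> set xs \<subseteq> B \<Longrightarrow> \<omega> xs \<in> B"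
  by (auto simp: subuniverse_def)

lemma monoid_End:
  assumes "alg A F"
  shows "monoid (End A F)"
proof
  have A: "subuniverse F A" using assms by (simp add: alg_def)
  show "\<alpha> \<otimes>\<^bsub>End A F\<^esub> \<beta> \<in> carrier (End A F)"
    if "\<alpha> \<in> carrier (End A F)" "\<beta> \<in> carrier (End A F)" for \<alpha> \<beta>
  proof -
    have \<alpha>: "\<alpha> \<in> endomorphisms A F" and \<beta>: "\<beta> \<in> endomorphisms A F" using that by auto
    have "compose A \<beta> \<alpha> (\<omega> xs) = \<omega> (map (compose A \<beta> \<alpha>) xs)"
      if "(length xs, \<omega>) \<in> F" "set xs \<subseteq> A" for \<omega> xs
    proof -
      have "set (map \<alpha> xs) \<subseteq> A" using that(2) \<alpha> by (auto intro: endomorphisms_mem)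
      then have "compose A \<beta> \<alpha> (\<omega> xs) = \<omega> (map \<beta> (map \<alpha> xs))"
        using that \<alpha> \<beta> subuniverse_op[OF A that]
        by (simp add: compose_eq endomorphisms_op del: map_map)
      also have "map \<beta> (map \<alpha> xs) = map (compose A \<beta> \<alpha>) xs"
        using that(2) by (auto simp: compose_eq)
      finally show ?thesis .
    qed
    moreover have "compose A \<beta> \<alpha> \<in> A \<rightarrow>\<^sub>E A"
      using \<alpha> \<beta> by (auto simp: compose_def intro: endomorphisms_mem)
    ultimately show ?thesis by (simp add: endomorphismsI)
  qed
  show "\<one>\<^bsub>End A F\<^esub> \<in> carrier (End A F)"
  proof -
    have "map (\<lambda>x\<in>A. x) xs = xs" if "set xs \<subseteq> A" for xs
      using that by (intro map_idI) auto
    then show ?thesis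
      using subuniverse_op[OF A] by (auto simp: End_def endomorphisms_def)
  qed
qed (auto simp: End_def endomorphisms_def fun_eq_iff compose_def PiE_iff extensional_def)

section \<open>Induction over generators, cancellation, and faithfulness of the two actions\<close>

lemma representable_induct:
  assumes "representable A F I" and "a \<in> A"
    and "subuniverse F {a \<in> A. P a}"
    and "\<And>\<alpha> x. \<alpha> \<in> I \<Longrightarrow> x \<in> A \<Longrightarrow> \<alpha> x \<in> A \<and> P (\<alpha> x)"
  shows "P a"
proof -
  have "Im_of A I \<subseteq> {a \<in> A. P a}" using assms(4) by (auto simp: Im_of_def)
  then have "subuniverse F hull Im_of A I \<subseteq> {a \<in> A. P a}"
    using assms(3) by (rule hull_minimal)
  then show ?thesis using assms(1,2) by (auto simp: representable_def)
qed

lemma separableD: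
  assumes "separable A I" and "a \<in> A" and "b \<in> A" and "\<And>\<alpha>. \<alpha> \<in> I \<Longrightarrow> \<alpha> a = \<alpha> b"
  shows "a = b"
proof -
  have "(a, b) \<in> ker_of A I" using assms(2-) by (auto simp: ker_of_def ker_map_def)
  then show ?thesis using assms(1) by (auto simp: separable_def Id_on_def)
qed

text \<open>Equal left translations mean that no member of \<open>I\<close> distinguishes
  \<open>f a\<close> from \<open>g a\<close>.\<close>

lemma inj_on_lambda_of:
  assumes "separable A I"
  shows "inj_on (lambda_of (End A F) I) (endomorphisms A F)"
proof
  fix f g
  assume f: "f \<in> endomorphisms A F" and g: "g \<in> endomorphisms A F"
    and eq: "lambda_of (End A F) I f = lambda_of (End A F) I g"
  have "f a = g a" if "a \<in> A" for a
  proof (rule separableD[OF assms])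
    fix \<alpha> assume "\<alpha> \<in> I"
    then have "compose A \<alpha> f = compose A \<alpha> g"
      using fun_cong[OF eq, of \<alpha>] by (simp add: lambda_of_def)
    then show "\<alpha> (f a) = \<alpha> (g a)" using that by (metis compose_eq)
  qed (use f g that in \<open>auto intro: endomorphisms_mem\<close>)
  with f g show "f = g" by (rule endomorphisms_ext)
qed

text \<open>The equaliser of two endomorphisms is a subuniverse; equal right translations put
  \<open>Im I\<close> into it, so it is all of \<open>A\<close>.\<close>

lemma inj_on_rho_of:
  assumes "alg A F" and "I \<subseteq> endomorphisms A F" and "representable A F I"
  shows "inj_on (rho_of (End A F) I) (endomorphisms A F)"
proof
  fix f g
  assume f: "f \<in> endomorphisms A F" and g: "g \<in> endomorphisms A F"
    and eq: "rho_of (End A F) I f = rho_of (End A F) I g"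
  have sub: "subuniverse F {a \<in> A. f a = g a}"
    unfolding subuniverse_def
  proof clarify
    fix \<omega> and xs :: "'a list"
    assume \<omega>: "(length xs, \<omega>) \<in> F" and xs: "set xs \<subseteq> {a \<in> A. f a = g a}"
    have A: "set xs \<subseteq> A" and eq: "map f xs = map g xs" using xs by auto
    have "f (\<omega> xs) = g (\<omega> xs)"
      unfolding endomorphisms_op[OF f \<omega> A] endomorphisms_op[OF g \<omega> A] eq ..
    then show "\<omega> xs \<in> A \<and> f (\<omega> xs) = g (\<omega> xs)"
      using assms(1) \<omega> A by (simp add: alg_def subuniverse_op)
  qed
  have "f a = g a" if "a \<in> A" for a
    using assms(3) that sub
  proof (rule representable_induct)
    fix \<alpha> x assume "\<alpha> \<in> I" and "x \<in> A"
    moreover from this have "compose A f \<alpha> = compose A g \<alpha>"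
      using fun_cong[OF eq, of \<alpha>] by (simp add: rho_of_def)
    ultimately show "\<alpha> x \<in> A \<and> f (\<alpha> x) = g (\<alpha> x)"
      using assms(2) by (metis compose_eq endomorphisms_mem subsetD)
  qed
  with f g show "f = g" by (rule endomorphisms_ext)
qed

section \<open>Realising a bi-translation by one endomorphism\<close>

lemma bi_translation_imp_idealiser:
  assumes alg: "alg A F" and I: "I \<subseteq> endomorphisms A F"
    and rep: "representable A F I" and sep: "separable A I"
    and bi: "bi_translation ((End A F)\<lparr>carrier := I\<rparr>) (l, r)"
  obtains f where "f \<in> idealiser (End A F) I"
    and "l = lambda_of (End A F) I f" and "r = rho_of (End A F) I f"
proof -
  have l: "l \<in> I \<rightarrow>\<^sub>E I" and r: "r \<in> I \<rightarrow>\<^sub>E I"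
    and linked: "\<And>\<alpha> \<beta>. \<alpha> \<in> I \<Longrightarrow> \<beta> \<in> I \<Longrightarrow> compose A (l \<beta>) \<alpha> = compose A \<beta> (r \<alpha>)"
    using bi by (auto simp: bi_translation_def left_translation_def right_translation_def)
  have lI: "l \<beta> \<in> I" and rI: "r \<beta> \<in> I" if "\<beta> \<in> I" for \<beta>
    using l r that by auto
  have I_mem: "\<alpha> x \<in> A" if "\<alpha> \<in> I" "x \<in> A" for \<alpha> x
    using that I by (blast intro: endomorphisms_mem)
  \<comment> \<open>Extensionality of the members of \<open>I\<close>; it settles equality of maps
    outside \<open>A\<close>.\<close>
  have I_arb: "\<alpha> x = undefined" if "\<alpha> \<in> I" "x \<notin> A" for \<alpha> x
    using that I by (meson PiE_arb endomorphisms_PiE subsetD)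
  have link: "l \<beta> (\<alpha> x) = \<beta> (r \<alpha> x)" if "\<alpha> \<in> I" "\<beta> \<in> I" "x \<in> A" for \<alpha> \<beta> x
    using linked[OF that(1,2)] that(3) by (metis compose_eq)
  \<comment> \<open>\<open>Q a b\<close> makes \<open>b\<close> a candidate for the image of
    \<open>a\<close> under the endomorphism sought. A relation is used because existence and
    uniqueness of \<open>b\<close> come from different hypotheses.\<close>
  define Q where "Q a b \<longleftrightarrow> b \<in> A \<and> (\<forall>\<beta>\<in>I. \<beta> b = l \<beta> a)" for a b
  \<comment> \<open>Here \<open>h\<close> is any choice of candidates for the entries of
    \<open>xs\<close>. An arbitrary choice gives closure of the domain of \<open>Q\<close>; the
    choice \<open>f\<close> gives the homomorphism law.\<close>
  have Q_op: "Q (\<omega> xs) (\<omega> (map h xs))"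
    if "(length xs, \<omega>) \<in> F" and xs: "set xs \<subseteq> A" and h: "\<And>x. x \<in> set xs \<Longrightarrow> Q x (h x)"
    for \<omega> xs h
  proof -
    have hA: "set (map h xs) \<subseteq> A" using h by (auto simp: Q_def)
    have "\<beta> (\<omega> (map h xs)) = l \<beta> (\<omega> xs)" if "\<beta> \<in> I" for \<beta>
    proof -
      have "\<beta> (\<omega> (map h xs)) = \<omega> (map \<beta> (map h xs))"
        using I that hA \<open>(length xs, \<omega>) \<in> F\<close> by (intro endomorphisms_op[of \<beta> A F]) auto
      also have "map \<beta> (map h xs) = map (l \<beta>) xs" using h that by (simp add: Q_def)
      also have "\<omega> (map (l \<beta>) xs) = l \<beta> (\<omega> xs)"
        using I lI[OF that] xs \<open>(length xs, \<omega>) \<in> F\<close>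
        by (intro endomorphisms_op[of "l \<beta>" A F, symmetric]) auto
      finally show ?thesis .
    qed
    moreover have "\<omega> (map h xs) \<in> A"
      using alg that(1) hA subuniverse_op[of F A "map h xs" \<omega>] by (simp add: alg_def)
    ultimately show ?thesis by (simp add: Q_def)
  qed
  have Q_unique: "b = c" if "Q a b" "Q a c" for a b c
    by (rule separableD[OF sep]) (use that in \<open>auto simp: Q_def\<close>)
  have Q_gen: "Q (\<alpha> x) (r \<alpha> x)" if "\<alpha> \<in> I" "x \<in> A" for \<alpha> x
    using that link[OF that(1) _ that(2)] I_mem rI by (simp add: Q_def)
  have sub: "subuniverse F {a \<in> A. \<exists>b. Q a b}"
    unfolding subuniverse_def
  proof clarify
    fix \<omega> and xs :: "'a list"
    assume \<omega>: "(length xs, \<omega>) \<in> F" and xs: "set xs \<subseteq> {a \<in> A. \<exists>b. Q a b}"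
    then have "Q (\<omega> xs) (\<omega> (map (\<lambda>x. SOME b. Q x b) xs))"
      using Q_op[where xs = xs and \<omega> = \<omega> and h = "\<lambda>x. SOME b. Q x b"] someI_ex
      by (metis (mono_tags, lifting) mem_Collect_eq subset_eq)
    moreover have "\<omega> xs \<in> A"
      using alg \<omega> xs subuniverse_op[of F A xs \<omega>] by (auto simp: alg_def)
    ultimately show "\<omega> xs \<in> A \<and> (\<exists>b. Q (\<omega> xs) b)" by blast
  qed
  have Q_exists: "\<exists>b. Q a b" if "a \<in> A" for a
    using rep that sub
  proof (rule representable_induct)
    fix \<alpha> x assume "\<alpha> \<in> I" and "x \<in> A"
    then show "\<alpha> x \<in> A \<and> (\<exists>b. Q (\<alpha> x) b)"
      using Q_gen I_mem by blast
  qed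
  define f where "f = (\<lambda>a\<in>A. SOME b. Q a b)"
  have Qf: "Q a (f a)" if "a \<in> A" for a
    using someI_ex[OF Q_exists[OF that]] that by (simp add: f_def)
  have fA: "f a \<in> A" if "a \<in> A" for a using Qf[OF that] by (simp add: Q_def)
  have f: "f \<in> endomorphisms A F"
  proof -
    \<comment> \<open>Both sides are candidates for the same element
      \<open>\<omega> xs\<close>.\<close>
    have "f (\<omega> xs) = \<omega> (map f xs)" if "(length xs, \<omega>) \<in> F" "set xs \<subseteq> A" for \<omega> xs
    proof (rule Q_unique)
      show "Q (\<omega> xs) (f (\<omega> xs))"
        using alg that by (intro Qf) (simp add: alg_def subuniverse_op)
      show "Q (\<omega> xs) (\<omega> (map f xs))" by (rule Q_op) (use that Qf in auto)
    qed
    moreover have "f \<in> A \<rightarrow>\<^sub>E A" using fA by (auto simp: f_def)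
    ultimately show ?thesis by (simp add: endomorphismsI)
  qed
  \<comment> \<open>On \<open>A\<close> this is the defining property of \<open>Q\<close>; elsewhere
    both sides are \<open>undefined\<close>.\<close>
  have lf: "compose A \<beta> f = l \<beta>" if "\<beta> \<in> I" for \<beta>
  proof
    fix a
    show "compose A \<beta> f a = l \<beta> a"
      using Qf[of a] that I_arb[OF lI[OF that], of a]
      by (cases "a \<in> A") (auto simp: compose_def Q_def)
  qed
  have rf: "compose A f \<alpha> = r \<alpha>" if "\<alpha> \<in> I" for \<alpha>
  proof
    fix a
    show "compose A f \<alpha> a = r \<alpha> a"
    proof (cases "a \<in> A")
      case True
      \<comment> \<open>By linkedness \<open>r \<alpha> a\<close> is a candidate for
        \<open>\<alpha> a\<close>, as is \<open>f (\<alpha> a)\<close>.\<close>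
      then have "f (\<alpha> a) = r \<alpha> a"
        using Q_unique[OF Qf Q_gen] I_mem that by blast
      then show ?thesis using True by (simp add: compose_eq)
    next
      case False
      then show ?thesis
        using I_arb[OF rI[OF that]] by (simp add: compose_def)
    qed
  qed
  show thesis
  proof (rule that)
    \<comment> \<open>The products of \<open>f\<close> with members of \<open>I\<close> are values
      of \<open>l\<close> and \<open>r\<close>, hence in \<open>I\<close>.\<close>
    show "f \<in> idealiser (End A F) I" using f lf rf lI rI by (simp add: idealiser_def)
    show "l = lambda_of (End A F) I f"
    proof
      show "l \<alpha> = lambda_of (End A F) I f \<alpha>" for \<alpha>
        using lf PiE_arb[OF l] by (cases "\<alpha> \<in> I") (simp_all add: lambda_of_def)
    qed
    show "r = rho_of (End A F) I f"
    proof
      show "r \<alpha> = rho_of (End A F) I f \<alpha>" for \<alpha>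
        using rf PiE_arb[OF r] by (cases "\<alpha> \<in> I") (simp_all add: rho_of_def)
    qed
  qed
qed

text \<open>The other natural isomorphisms are inverses and composites of these four:
  \<open>f \<mapsto> (\<lambda>_f, \<rho>_f)\<close> is \<open>rho_of\<close> followed by the
  inverse of \<open>snd\<close>.\<close>

theorem theorem3p15:
  fixes A :: "'a set" and F :: "'a operation set" and I :: "('a \<Rightarrow> 'a) set"
  assumes "alg A F"
    and "subsemigroup I (End A F)"
    and "representable A F I"
    and "separable A I"
  shows "carrier (Rho_tilde ((End A F)\<lparr>carrier := I\<rparr>)) =
           {rho_of (End A F) I f | f. f \<in> idealiser (End A F) I} \<and>
         carrier (Lambda_tilde ((End A F)\<lparr>carrier := I\<rparr>)) =
           {lambda_of (End A F) I f | f. f \<in> idealiser (End A F) I} \<and>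
         carrier (Omega ((End A F)\<lparr>carrier := I\<rparr>)) =
           {(lambda_of (End A F) I f, rho_of (End A F) I f) | f. f \<in> idealiser (End A F) I} \<and>
         snd \<in> iso (Omega ((End A F)\<lparr>carrier := I\<rparr>)) (Rho_tilde ((End A F)\<lparr>carrier := I\<rparr>)) \<and>
         fst \<in> iso (Omega ((End A F)\<lparr>carrier := I\<rparr>)) (Lambda_tilde ((End A F)\<lparr>carrier := I\<rparr>)) \<and>
         rho_of (End A F) I \<in>
           iso ((End A F)\<lparr>carrier := idealiser (End A F) I\<rparr>)
               (Rho_tilde ((End A F)\<lparr>carrier := I\<rparr>)) \<and>
         lambda_of (End A F) I \<in>
           iso ((End A F)\<lparr>carrier := idealiser (End A F) I\<rparr>)
               (Lambda_tilde ((End A F)\<lparr>carrier := I\<rparr>))"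
proof -
  let ?E = "End A F"
  let ?S = "idealiser ?E I" and ?K = "?E\<lparr>carrier := I\<rparr>"
  let ?l = "lambda_of ?E I" and ?r = "rho_of ?E I"
  have mon: "monoid ?E" using assms(1) by (rule monoid_End)
  have I: "I \<subseteq> carrier ?E"
    and closed: "\<And>\<alpha> \<beta>. \<alpha> \<in> I \<Longrightarrow> \<beta> \<in> I \<Longrightarrow> \<alpha> \<otimes>\<^bsub>?E\<^esub> \<beta> \<in> I"
    using assms(2) by (auto simp: subsemigroup_def)
  have S: "?S \<subseteq> carrier ?E" by (auto simp: idealiser_def)
  have inj_l: "inj_on ?l ?S"
    using inj_on_lambda_of[OF assms(4)] S by (auto intro: inj_on_subset)
  have inj_r: "inj_on ?r ?S"
    using inj_on_rho_of[OF assms(1) _ assms(3)] I S by (auto intro: inj_on_subset)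
  have Om: "carrier (Omega ?K) = (\<lambda>f. (?l f, ?r f)) ` ?S"
  proof (intro equalityI subsetI)
    fix p assume "p \<in> carrier (Omega ?K)"
    then have "bi_translation ?K (fst p, snd p)" by (simp add: Omega_def)
    with assms(1) I[unfolded carrier_End] assms(3,4)
    obtain f where "f \<in> ?S" "fst p = ?l f" "snd p = ?r f"
      by (rule bi_translation_imp_idealiser)
    then show "p \<in> (\<lambda>f. (?l f, ?r f)) ` ?S" by (auto simp: prod_eq_iff)
  next
    fix p assume "p \<in> (\<lambda>f. (?l f, ?r f)) ` ?S"
    then show "p \<in> carrier (Omega ?K)"
      using bi_translation_idealiser[OF mon I _ closed] by (auto simp: Omega_def)
  qed
  have Rh: "carrier (Rho_tilde ?K) = ?r ` ?S"
    by (simp add: Rho_tilde_def Om image_image)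
  have La: "carrier (Lambda_tilde ?K) = ?l ` ?S"
    by (simp add: Lambda_tilde_def Om image_image)
  \<comment> \<open>Either coordinate of a pair in \<open>Omega\<close> determines \<open>f\<close>,
    and thereby the other coordinate.\<close>
  have "inj_on snd (carrier (Omega ?K))" "inj_on fst (carrier (Omega ?K))"
    using inj_l inj_r by (auto simp: Om inj_on_def)
  then have "snd \<in> iso (Omega ?K) (Rho_tilde ?K)" "fst \<in> iso (Omega ?K) (Lambda_tilde ?K)"
    by (auto simp: iso_def hom_def bij_betw_def Rho_tilde_def Lambda_tilde_def)
      (auto simp: Omega_def)
  moreover have "?r \<in> iso (?E\<lparr>carrier := ?S\<rparr>) (Rho_tilde ?K)"
  proof -
    have "?r (f \<otimes>\<^bsub>?E\<^esub> g) = compose I (?r g) (?r f)" if "f \<in> ?S" "g \<in> ?S" for f g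
      using that S by (intro rho_of_mult[OF mon I]) auto
    then have "?r \<in> hom (?E\<lparr>carrier := ?S\<rparr>) (Rho_tilde ?K)"
      by (auto simp: hom_def Rh) (simp add: Rho_tilde_def)
    then show ?thesis using inj_r by (simp add: iso_def bij_betw_def Rh)
  qed
  moreover have "?l \<in> iso (?E\<lparr>carrier := ?S\<rparr>) (Lambda_tilde ?K)"
  proof -
    have "?l (f \<otimes>\<^bsub>?E\<^esub> g) = compose I (?l f) (?l g)" if "f \<in> ?S" "g \<in> ?S" for f g
      using that S by (intro lambda_of_mult[OF mon I]) auto
    then have "?l \<in> hom (?E\<lparr>carrier := ?S\<rparr>) (Lambda_tilde ?K)"
      by (auto simp: hom_def La) (simp add: Lambda_tilde_def)
    then show ?thesis using inj_l by (simp add: iso_def bij_betw_def La)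
  qed
  ultimately show ?thesis by (simp add: Rh La Om Setcompr_eq_image)
qed

end
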